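(* Let $m\in\mathbb N$ and let $t$ be an $(m,\mathbf a,\mathbf b)$-Collatz map with iterates $t_k$, constants $\lambda_r,\mu_r$, and generating functions $f_k$ and $F$ (all as defined in the context). Then the following hold. (S1.a) Let $z\in\mathbb D_*$ and $r\in\{0,\dots,m-1\}$. There exist unique complex numbers $\sigma_{r,l}(z)$ ($0\le l\le \mu_r-\lambda_r$) and $\tau_{r,l}(z)$ ($0\le l\le\lambda_r-1$) such that, as an identity of rational functions in $u$, $$\frac{1}{u^{\mu_r-\lambda_r+1}(u^{\lambda_r}-z^m)}=\frac{1}{u^{\mu_r-\lambda_r+1}\prod_{l=0}^{\lambda_r-1}(u-\phi_{r,l}(z))}=\sum_{l=0}^{\mu_r-\lambda_r}\frac{\sigma_{r,l}(z)}{u^{l+1}}+\sum_{l=0}^{\lambda_r-1}\frac{\tau_{r,l}(z)}{u-\phi_{r,l}(z)},$$ where $\phi_{r,l}(z):=z^{m/\lambda_r}e^{i2\pi l/\lambda_r}$. (S1.b) For all $z\in\mathbb D_*$ and $k\in\mathbb N$, $$f_k(z)=\sum_{r=0}^{m-1}\frac{z^r}{2\pi i}\oint_{|u|=\rho}\frac{f_{k-1}(u)}{u^{\mu_r-\lambda_r+1}(u^{\lambda_r}-z^m)}\,du$$ for every radius $\rho>0$ with $|z|^{1/\|\mathbf a\|_{\max}}<\rho<1$, and $$f_k(z)=\sum_{r=0}^{m-1}z^r\left(\sum_{l=0}^{\mu_r-\lambda_r}\frac{\sigma_{r,l}(z)}{l!}f_{k-1}^{(l)}(0)+\sum_{l=0}^{\lambda_r-1}\tau_{r,l}(z)\,f_{k-1}(\phi_{r,l}(z))\right),$$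 with initial condition $f_0(z)=\frac{z}{(1-z)^2}$. (S1.c) For all $z\in\mathbb D_*$ and $w\in\mathbb C$ with $|w|<R_w$, $$F(z,w)=f_0(z)+w\sum_{r=0}^{m-1}z^r\left(\sum_{l=0}^{\mu_r-\lambda_r}\frac{\sigma_{r,l}(z)}{l!}F_*^{(l)}(0,w)+\sum_{l=0}^{\lambda_r-1}\tau_{r,l}(z)\,F(\phi_{r,l}(z),w)\right),$$ where $F_*^{(l)}(0,w):=\left.\frac{\partial^lF(z,w)}{\partial z^l}\right|_{z=0}$.
   Context: $\mathbb N=\{1,2,\dots\}$, $\mathbb N_0=\mathbb N\cup\{0\}$, $\mathbb D=\{z\in\mathbb C:|z|<1\}$, $\mathbb D_*=\mathbb D\setminus\{0\}$. Empty sums (upper limit smaller than lower limit) are $0$, empty products are $1$, $0^0=1$, $0!=1$. For a vector, $\|\cdot\|_{\max}$ is the maximum of the absolute values of its components. Contour integrals are taken counterclockwise. $(m,\mathbf a,\mathbf b)$-Collatz map: let $m\in\mathbb N$ and let $\mathbf a=[a_0,\dots,a_{m-1}]^\top$, $\mathbf b=[b_0,\dots,b_{m-1}]^\top$ be real vectors such that for all $r\in\{0,\dots,m-1\}$: $\lambda_r:=a_rm\in\mathbb N$ and $\mu_r:=a_rr+b_r\in\mathbb N_0$. The map $t:\mathbb N_0\to\mathbb N_0$ is $t(n):=a_rn+b_r$ if $n\equiv r\pmod m$, $r\in\{0,\dots,m-1\}$ (it takes values in $\mathbb N_0$: if $n=qm+r$ then $t(n)=q\lambda_r+\mu_r$).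 Iterates: $t_0(n):=n$, $t_k(n):=t(t_{k-1}(n))$ for $k\in\mathbb N$. Let $R_w:=\min\{\|\mathbf a\|_{\max}^{-1},1\}>0$. Generating functions: $f_k(z):=\sum_{n=0}^\infty t_k(n)z^n$ for $z\in\mathbb D$, $k\in\mathbb N_0$, and $F(z,w):=\sum_{k=0}^\infty\sum_{n=0}^\infty t_k(n)z^nw^k=\sum_{k=0}^\infty f_k(z)w^k$ for $z\in\mathbb D$, $|w|<R_w$; these series converge and define holomorphic functions on these domains. $f^{(l)}$ denotes the $l$-th complex derivative. For $z\neq0$, $z^{m/\lambda_r}$ denotes a fixed determination of the complex power (e.g. the principal value), so that $\phi_{r,0}(z),\dots,\phi_{r,\lambda_r-1}(z)$ are exactly all the complex solutions $u$ of $u^{\lambda_r}=z^m$. When $\mu_r-\lambda_r<0$ the sum over $\sigma_{r,l}$ is empty. *)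

theory Defs
  imports
    "HOL-Complex_Analysis.Complex_Analysis"
    "HOL-Computational_Algebra.Polynomial_Factorial"
begin

text \<open>
  The vectors \<open>a\<close>, \<open>b\<close> are functions on \<open>nat\<close> of which only the values at \<open>r < m\<close> are used.
\<close>

definition collatz_vectors :: "nat \<Rightarrow> (nat \<Rightarrow> real) \<Rightarrow> (nat \<Rightarrow> real) \<Rightarrow> bool" where
  "collatz_vectors m a b \<longleftrightarrow>
     m \<ge> 1 \<and> (\<forall>r<m. a r * real m \<in> \<nat> - {0} \<and> a r * real r + b r \<in> \<nat>)"

definition collatz_map :: "nat \<Rightarrow> (nat \<Rightarrow> real) \<Rightarrow> (nat \<Rightarrow> real) \<Rightarrow> (nat \<Rightarrow> nat) \<Rightarrow> bool" where
  "collatz_map m a b t \<longleftrightarrow>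
     collatz_vectors m a b \<and> (\<forall>n. real (t n) = a (n mod m) * real n + b (n mod m))"

text \<open>
  The defining formula always yields natural numbers, so the predicate determines \<open>t\<close>.
\<close>

lemma collatz_map_unique_exists:
  assumes "collatz_vectors m a b"
  shows "\<exists>!t. collatz_map m a b t"
proof -
  have "\<exists>k. real k = a (n mod m) * real n + b (n mod m)" for n
  proof -
    have "n mod m < m" using assms by (simp add: collatz_vectors_def)
    then obtain l u where l: "a (n mod m) * real m = real l"
      and u: "a (n mod m) * real (n mod m) + b (n mod m) = real u"
      using assms by (auto simp: collatz_vectors_def elim!: Nats_cases)
    have "real n = real m * real (n div m) + real (n mod m)"
      by (metis mult_div_mod_eq of_nat_add of_nat_mult)
    then have "a (n mod m) * real n + b (n mod m)
        = (a (n mod m) * real m) * real (n div m) + (a (n mod m) * real (n mod m) + b (n mod m))"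
      by (simp add: algebra_simps)
    also have "\<dots> = real (l * (n div m) + u)" by (simp add: l u)
    finally show ?thesis by metis
  qed
  then obtain t where "\<forall>n. real (t n) = a (n mod m) * real n + b (n mod m)" by metis
  then have "collatz_map m a b t" using assms by (simp add: collatz_map_def)
  moreover have "t' = t''" if "collatz_map m a b t'" "collatz_map m a b t''" for t' t''
  proof
    show "t' n = t'' n" for n
      using that unfolding collatz_map_def by (metis of_nat_eq_iff)
  qed
  ultimately show ?thesis by blast
qed

definition max_norm :: "nat \<Rightarrow> (nat \<Rightarrow> real) \<Rightarrow> real" where
  "max_norm m a = Max ((\<lambda>r. \<bar>a r\<bar>) ` {..<m})"

definition w_radius :: "nat \<Rightarrow> (nat \<Rightarrow> real) \<Rightarrow> real" where
  "w_radius m a = min (inverse (max_norm m a)) 1"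

definition gen_f :: "(nat \<Rightarrow> nat) \<Rightarrow> nat \<Rightarrow> complex \<Rightarrow> complex" where
  "gen_f t k z = (\<Sum>n. of_nat ((t ^^ k) n) * z ^ n)"

definition gen_F :: "(nat \<Rightarrow> nat) \<Rightarrow> complex \<Rightarrow> complex \<Rightarrow> complex" where
  "gen_F t z w = (\<Sum>k. \<Sum>n. of_nat ((t ^^ k) n) * z ^ n * w ^ k)"

text \<open>
  \<open>p\<close> is a value of the multivalued power \<open>z\<close> to the \<open>\<alpha>\<close>; the principal one is \<open>z powr of_real \<alpha>\<close>.
\<close>

definition power_determination :: "complex \<Rightarrow> real \<Rightarrow> complex \<Rightarrow> bool" where
  "power_determination z \<alpha> p \<longleftrightarrow> (\<exists>v. exp v = z \<and> p = exp (of_real \<alpha> * v))"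

text \<open>Here \<open>p\<close> stands for the chosen determination of \<open>z\<close> to the \<open>m / lam\<close>.\<close>

definition phi :: "complex \<Rightarrow> nat \<Rightarrow> nat \<Rightarrow> complex" where
  "phi p lam l = p * exp (\<i> * of_real (2 * pi * real l / real lam))"

text \<open>
  Rational functions in \<open>u\<close> are elements of the fraction field of the polynomial ring.
  The exponent \<open>mu - lam + 1\<close> is an integer and may be negative. The index range
  \<open>0 \<le> l \<le> mu - lam\<close> is \<open>l < mu + 1 - lam\<close> with truncated subtraction,
  which is empty exactly if \<open>mu < lam\<close>.
\<close>

abbreviation rat_u :: "complex poly fract" where
  "rat_u \<equiv> to_fract [:0, 1:]"

abbreviation rat_const :: "complex \<Rightarrow> complex poly fract" where
  "rat_const c \<equiv> to_fract [:c:]"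

definition partial_fractions ::
    "nat \<Rightarrow> nat \<Rightarrow> nat \<Rightarrow> complex \<Rightarrow> complex \<Rightarrow> (nat \<Rightarrow> complex) \<Rightarrow> (nat \<Rightarrow> complex) \<Rightarrow> bool" where
  "partial_fractions m lam mu z p sig tau \<longleftrightarrow>
     1 / (rat_u powi (int mu - int lam + 1) * (rat_u ^ lam - rat_const (z ^ m)))
       = 1 / (rat_u powi (int mu - int lam + 1) * (\<Prod>l<lam. rat_u - rat_const (phi p lam l)))
   \<and> 1 / (rat_u powi (int mu - int lam + 1) * (\<Prod>l<lam. rat_u - rat_const (phi p lam l)))
       = (\<Sum>l<mu + 1 - lam. rat_const (sig l) / rat_u ^ (l + 1))
         + (\<Sum>l<lam. rat_const (tau l) / (rat_u - rat_const (phi p lam l)))"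

end

theory Submission
  imports Defs
begin

text \<open>
  For \<open>|u|\<close> large, comparing the expansion
  \<open>1 / (u^(mu-lam+1) (u^lam - z^m)) = (\<Sum>q. z^(m q) / u^(mu + q lam + 1))\<close> with that of the partial
  fraction decomposition shows that \<open>sigma_n + (\<Sum>l. tau_l phi_l^n)\<close> equals \<open>z^(m q)\<close> if
  \<open>n = mu + q lam\<close> and vanishes for all other \<open>n\<close>. Multiplying by \<open>g n\<close> and summing over \<open>n\<close> turns
  this into a formula for \<open>\<Sum>q. g (t (q m + r)) z^(m q)\<close> in terms of the power series \<open>P\<close> with
  coefficients \<open>g\<close>, for every \<open>g\<close> of at most linear growth; the \<open>z^r\<close>-weighted sum over \<open>r\<close> is the operator in
  (S1.b) and (S1.c). It is applied to \<open>g = t_{k-1}\<close> for \<open>f_k\<close>, and to \<open>c n = (\<Sum>k. t_k(n) w^k)\<close> for \<open>F\<close>,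
  where \<open>c n = n + w c (t n)\<close>. The contour integrals follow from the decomposition by Cauchy's
  formulas.
\<close>

section \<open>Determinations of the complex power and the roots \<open>phi\<close>\<close>

lemma power_determination_power:
  assumes "power_determination z (real m / real L) p" "L > 0"
  shows "p ^ L = z ^ m"
proof -
  obtain v where v: "exp v = z" "p = exp (of_real (real m / real L) * v)"
    using assms(1) by (auto simp: power_determination_def)
  have "p ^ L = exp (of_nat L * (of_real (real m / real L) * v))"
    by (simp only: v(2) exp_of_nat_mult)
  also have "of_nat L * (of_real (real m / real L) * v) = of_nat m * v"
    using \<open>L > 0\<close> by simp
  finally show ?thesis by (simp add: v(1)[symmetric] exp_of_nat_mult)
qed

lemma norm_power_determination:
  assumes "power_determination z \<alpha> p"
  shows "norm p = norm z powr \<alpha>"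
proof -
  obtain v where "exp v = z" "p = exp (of_real \<alpha> * v)"
    using assms by (auto simp: power_determination_def)
  then show ?thesis by (auto simp: powr_def)
qed

lemma norm_phi: "norm (phi p L l) = norm p"
  by (simp add: phi_def norm_mult)

lemma phi_eq_cis: "phi p L l = p * cis (2 * pi * real l / real L)"
  by (simp add: phi_def cis_conv_exp)

lemma phi_power:
  assumes "L > 0"
  shows "phi p L l ^ L = p ^ L"
proof -
  have "cis (2 * pi * real l / real L) ^ L = cis (2 * pi * real l)"
    using assms by (simp add: Complex.DeMoivre del: cis_multiple_2pi)
  also have "\<dots> = 1" by (simp add: cis_multiple_2pi)
  finally show ?thesis by (simp add: phi_eq_cis power_mult_distrib)
qed

lemma inj_on_phi:
  assumes "p \<noteq> 0"
  shows "inj_on (phi p L) {..<L}"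
proof (cases "L > 0")
  case True
  have "inj_on (\<lambda>l. cis (2 * pi * real l / real L)) {..<L}"
    using Complex.bij_betw_roots_unity[OF True] by (auto simp: bij_betw_def)
  then show ?thesis using assms by (auto simp: inj_on_def phi_eq_cis)
qed auto

text \<open>Both sides are monic of degree \<open>L\<close> and agree at the \<open>L\<close>
  distinct points \<open>phi p L l\<close>, so they coincide.\<close>

lemma prod_phi:
  assumes "L > 0" "p \<noteq> 0"
  shows "(\<Prod>l<L. [:- phi p L l, 1:]) = monom 1 L - [:p ^ L:]"
proof -
  have c: "degree [:p ^ L:] < degree (monom (1::complex) L)"
    using assms by (simp add: degree_monom_eq)
  have "degree (monom 1 L + - [:p ^ L:]) = degree (monom (1::complex) L)"
    using c by (intro degree_add_eq_left) simp
  then have d: "degree (monom 1 L - [:p ^ L:]) = L"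
    by (simp only: diff_conv_add_uminus) (simp add: degree_monom_eq)
  have l: "lead_coeff (monom 1 L - [:p ^ L:]) = 1"
    unfolding d using assms by (cases L) auto
  have lp: "lead_coeff (\<Prod>l<L. [:- phi p L l, 1:]) = 1"
    by (simp add: lead_coeff_prod)
  have dp: "degree (\<Prod>l<L. [:- phi p L l, 1:]) = L"
    by (subst degree_prod_eq_sum_degree) auto
  show ?thesis
  proof (rule poly_eqI_degree_lead_coeff[where n = L and A = "phi p L ` {..<L}"])
    show "card (phi p L ` {..<L}) \<ge> L" using inj_on_phi[OF assms(2)] by (simp add: card_image)
  next
    fix x assume "x \<in> phi p L ` {..<L}"
    then show "poly (\<Prod>l<L. [:- phi p L l, 1:]) x = poly (monom 1 L - [:p ^ L:]) x"
      using assms by (auto simp: poly_prod poly_monom phi_power)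
  qed (use d dp l lp in auto)
qed

lemma prod_phi_eval:
  assumes "L > 0" "p \<noteq> 0"
  shows "(\<Prod>l<L. u - phi p L l) = u ^ L - p ^ L"
  using arg_cong[OF prod_phi[OF assms], of "\<lambda>q. poly q u"] by (simp add: poly_prod poly_monom)

section \<open>Partial fractions over a common denominator: existence and uniqueness\<close>

text \<open>
  The numerator of the decomposition over the common denominator \<open>u^M (\<Prod>l<L. u - phi p L l)\<close>, where
  \<open>M\<close> is the truncated difference \<open>mu + 1 - L\<close>. The numerator of the left-hand side is then \<open>u\<close> to the
  truncated difference \<open>L - (mu + 1)\<close>, since one of the two differences is 0.
\<close>

definition pf_poly :: "nat \<Rightarrow> nat \<Rightarrow> complex \<Rightarrow> (nat \<Rightarrow> complex) \<Rightarrow> (nat \<Rightarrow> complex) \<Rightarrow> complex poly" where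
  "pf_poly L M p sig tau =
     (\<Sum>l<M. monom (sig l) (M - Suc l)) * (\<Prod>l<L. [:- phi p L l, 1:])
     + (\<Sum>l<L. monom (tau l) M * (\<Prod>j\<in>{..<L} - {l}. [:- phi p L j, 1:]))"

text \<open>At the root with index \<open>l\<close> every summand containing the factor
  \<open>u - phi p L l\<close> vanishes. Evaluation therefore isolates \<open>tau l\<close>, which
  both produces the decomposition and makes it unique.\<close>

lemma poly_pf_poly_phi:
  assumes "l < L"
  shows "poly (pf_poly L M p sig tau) (phi p L l)
    = tau l * phi p L l ^ M * (\<Prod>j\<in>{..<L} - {l}. phi p L l - phi p L j)"
proof -
  have "(\<Sum>k<L. tau k * phi p L l ^ M * (\<Prod>j\<in>{..<L} - {k}. phi p L l - phi p L j))
     = (\<Sum>k<L. if k = l then tau l * phi p L l ^ M * (\<Prod>j\<in>{..<L} - {l}. phi p L l - phi p L j) else 0)"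
    using assms by (intro sum.cong) auto
  moreover have "(\<Prod>j<L. phi p L l - phi p L j) = 0" using assms by auto
  ultimately show ?thesis using assms
    by (simp add: pf_poly_def poly_sum poly_prod poly_monom)
qed

text \<open>The \<open>tau l\<close> are forced by the values of \<open>N\<close> at the roots.
  After subtracting their contribution \<open>S\<close>, the rest vanishes at all roots and hence is
  divisible by the product of the linear factors; the quotient has degree below \<open>M\<close>,
  and its coefficients are the \<open>sig l\<close>.\<close>

lemma pf_poly_exists:
  assumes "p \<noteq> 0" "degree N < L + M"
  shows "\<exists>sig tau. N = pf_poly L M p sig tau"
proof -
  define tau where "tau l = poly N (phi p L l)
    / (phi p L l ^ M * (\<Prod>j\<in>{..<L} - {l}. phi p L l - phi p L j))" for l
  define S where "S = (\<Sum>l<L. monom (tau l) M * (\<Prod>j\<in>{..<L} - {l}. [:- phi p L j, 1:]))"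
  let ?P = "\<Prod>l<L. [:- phi p L l, 1:]"
  have ph0: "phi p L l \<noteq> 0" for l using assms(1) by (simp add: phi_def)
  have root: "poly (N - S) (phi p L l) = 0" if l: "l < L" for l
  proof -
    have "(\<Prod>j\<in>{..<L} - {l}. phi p L l - phi p L j) \<noteq> 0"
      using inj_on_phi[OF assms(1), of L] l by (auto simp: inj_on_def)
    \<comment> \<open>\<open>S\<close> is \<open>pf_poly\<close> with all \<open>sig\<close> equal
      to 0, so the evaluation lemma applies to it; by the choice of \<open>tau\<close> its value at
      the root is that of \<open>N\<close>.\<close>
    moreover have "poly S (phi p L l) = poly (pf_poly L M p (\<lambda>_. 0) tau) (phi p L l)"
      by (simp add: S_def pf_poly_def)
    ultimately show ?thesis using l ph0[of l] by (simp add: poly_pf_poly_phi tau_def)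
  qed
  have degP: "degree ?P = L" by (subst degree_prod_eq_sum_degree) auto
  have P0: "?P \<noteq> 0" by simp
  define Q where "Q = (N - S) div ?P"
  \<comment> \<open>The remainder has degree below \<open>L\<close> but vanishes at the
    \<open>L\<close> distinct roots.\<close>
  have dmod: "(N - S) mod ?P = 0"
  proof (rule ccontr)
    assume nz: "(N - S) mod ?P \<noteq> 0"
    have d: "degree ((N - S) mod ?P) < L"
      using degree_mod_less[OF P0, of "N - S"] nz degP by simp
    have "poly ((N - S) mod ?P) x = poly 0 x" if x: "x \<in> phi p L ` {..<L}" for x
    proof -
      have "poly (N - S) x = poly ((N - S) div ?P) x * poly ?P x + poly ((N - S) mod ?P) x"
        by (metis div_mult_mod_eq poly_add poly_mult)
      moreover have "poly ?P x = 0" using x by (auto simp: poly_prod)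
      ultimately show ?thesis using root x by auto
    qed
    then have "(N - S) mod ?P = 0"
      by (rule poly_eqI_degree)
        (use d in \<open>auto simp: card_image[OF inj_on_phi[OF assms(1)]]\<close>)
    with nz show False by simp
  qed
  have NS: "N - S = Q * ?P" using dmod by (metis Q_def add.right_neutral div_mult_mod_eq)
  \<comment> \<open>\<open>N\<close> and \<open>S\<close> have degree below \<open>L + M\<close> and
    the divisor has degree \<open>L\<close>, which leaves less than \<open>M\<close> for a nonzero
    \<open>Q\<close>.\<close>
  have cQ: "coeff Q n = 0" if n: "n \<ge> M" for n
  proof (cases "Q = 0")
    case False
    have "degree (monom (tau l) M * (\<Prod>j\<in>{..<L} - {l}. [:- phi p L j, 1:])) < L + M"
      if l: "l < L" for l
    proof -
      have "degree (\<Prod>j\<in>{..<L} - {l}. [:- phi p L j, 1:]) = L - 1"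
        by (subst degree_prod_eq_sum_degree) (use l in auto)
      then have "degree (monom (tau l) M * (\<Prod>j\<in>{..<L} - {l}. [:- phi p L j, 1:])) \<le> M + (L - 1)"
        by (metis add_mono degree_monom_le degree_mult_le le_refl order_trans)
      then show ?thesis using l by linarith
    qed
    then have "degree S < L + M" unfolding S_def
      using assms(2) by (intro degree_sum_less) auto
    then have "degree (N - S) < L + M" using assms(2) degree_diff_less by blast
    moreover have "degree (N - S) = degree Q + L"
      unfolding NS using False P0 degP by (subst degree_mult_eq) auto
    ultimately show ?thesis using n by (intro coeff_eq_0) simp
  qed auto
  \<comment> \<open>The coefficients of \<open>Q\<close> are read backwards: over the common
    denominator \<open>u^M\<close>, the term \<open>sig l / u^(l+1)\<close> has numerator
    \<open>sig l * u^(M - Suc l)\<close>.\<close>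
  have "(\<Sum>l<M. monom (coeff Q (M - Suc l)) (M - Suc l)) = (\<Sum>l<M. monom (coeff Q l) l)"
    by (rule sum.nat_diff_reindex)
  also have "\<dots> = Q"
    by (rule poly_eqI) (use cQ in \<open>auto simp: coeff_sum\<close>)
  finally have "N = pf_poly L M p (\<lambda>l. coeff Q (M - Suc l)) tau"
    using NS unfolding pf_poly_def S_def by (simp add: algebra_simps)
  then show ?thesis by blast
qed

text \<open>Evaluation at the roots determines every \<open>tau l\<close>. Once these parts are
  cancelled, the nonzero product of linear factors can be cancelled as well, and the
  \<open>sig l\<close> are compared as coefficients.\<close>

lemma pf_poly_unique:
  assumes "p \<noteq> 0" "pf_poly L M p sig tau = pf_poly L M p sig' tau'"
  shows "\<forall>l<M. sig l = sig' l" "\<forall>l<L. tau l = tau' l"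
proof -
  show tau: "\<forall>l<L. tau l = tau' l"
  proof (intro allI impI)
    fix l assume l: "l < L"
    have "(\<Prod>j\<in>{..<L} - {l}. phi p L l - phi p L j) \<noteq> 0"
      using inj_on_phi[OF assms(1), of L] l by (auto simp: inj_on_def)
    moreover have "phi p L l \<noteq> 0" using assms(1) by (simp add: phi_def)
    ultimately show "tau l = tau' l"
      using arg_cong[OF assms(2), of "\<lambda>q. poly q (phi p L l)"] l by (simp add: poly_pf_poly_phi)
  qed
  have "(\<Sum>l<L. monom (tau l) M * (\<Prod>j\<in>{..<L} - {l}. [:- phi p L j, 1:]))
      = (\<Sum>l<L. monom (tau' l) M * (\<Prod>j\<in>{..<L} - {l}. [:- phi p L j, 1:]))"
    using tau by (intro sum.cong) auto
  then have eq: "(\<Sum>l<M. monom (sig l) (M - Suc l)) = (\<Sum>l<M. monom (sig' l) (M - Suc l))"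
    using assms(2) by (simp add: pf_poly_def)
  show "\<forall>l<M. sig l = sig' l"
  proof (intro allI impI)
    fix l assume l: "l < M"
    have "coeff (\<Sum>k<M. monom (s k) (M - Suc k)) (M - Suc l) = s l" for s :: "nat \<Rightarrow> complex"
    proof -
      have "coeff (\<Sum>k<M. monom (s k) (M - Suc k)) (M - Suc l) = (\<Sum>k<M. if k = l then s l else 0)"
        unfolding coeff_sum by (rule sum.cong) (use l in auto)
      then show ?thesis using l by simp
    qed
    then show "sig l = sig' l" using eq by metis
  qed
qed

section \<open>From rational functions to polynomials and to complex values\<close>

lemma to_fract_power: "to_fract (x ^ n) = to_fract x ^ n"
  by (induction n) auto

lemma to_fract_prod: "to_fract (prod f A) = (\<Prod>x\<in>A. to_fract (f x))"
  by (induction A rule: infinite_finite_induct) auto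

text \<open>At most one of the two truncated differences is nonzero, so this quotient handles both
  signs of the integer exponent and \<open>x = 0\<close> needs no exception.\<close>

lemma power_int_diff_truncated:
  fixes x :: "'a :: field"
  shows "x powi (int n - int L + 1) = x ^ (n + 1 - L) / x ^ (L - (n + 1))"
proof (cases "n + 1 \<ge> L")
  case True
  then have "int n - int L + 1 = int (n + 1 - L)" by simp
  then show ?thesis using True by (simp only: power_int_of_nat) simp
next
  case False
  then have e: "int n - int L + 1 = - int (L - (n + 1))" by simp
  show ?thesis unfolding e power_int_minus power_int_of_nat using False by (simp add: field_simps)
qed

text \<open>All terms are brought to the denominator \<open>u^M\<close> times the product of the
  linear factors, which is nonzero in the fraction field; \<open>to_fract\<close> is injective, so
  only numerators remain. The first equation in \<open>partial_fractions\<close> is the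
  factorization of \<open>u^L - z^m\<close>.\<close>

lemma partial_fractions_iff:
  assumes "L > 0" "p \<noteq> 0" "p ^ L = z ^ m"
  shows "partial_fractions m L mu z p sig tau \<longleftrightarrow>
    monom 1 (L - (mu + 1)) = pf_poly L (mu + 1 - L) p sig tau"
proof -
  let ?M = "mu + 1 - L" and ?k = "L - (mu + 1)"
  let ?U = "rat_u" and ?F = "\<lambda>l. rat_u - rat_const (phi p L l)"
  let ?P = "\<Prod>l<L. ?F l"
  have F: "?F l = to_fract [:- phi p L l, 1:]" for l by (simp flip: to_fract_diff)
  have F0: "?F l \<noteq> 0" for l unfolding F by simp
  have U0: "?U \<noteq> 0" by simp
  have P: "?P = to_fract (\<Prod>l<L. [:- phi p L l, 1:])" by (simp add: F to_fract_prod)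
  have P0: "?P \<noteq> 0" using F0 by auto
  have X: "(monom 1 n :: complex poly) = [:0, 1:] ^ n" for n by (simp add: monom_altdef)
  have mon: "to_fract (monom c n) = rat_const c * ?U ^ n" for c n
  proof -
    have "monom c n = [:c:] * [:0, 1:] ^ n" by (simp add: monom_altdef)
    then show ?thesis by (simp only: to_fract_mult to_fract_power)
  qed
  have "to_fract (monom 1 L - [:p ^ L:]) = ?U ^ L - rat_const (z ^ m)"
    by (simp add: X to_fract_power assms(3))
  then have den: "?U ^ L - rat_const (z ^ m) = ?P"
    using prod_phi[OF assms(1,2)] P by simp
  have pw: "?U powi (int mu - int L + 1) = ?U ^ ?M / ?U ^ ?k"
    by (rule power_int_diff_truncated)
  have tau: "rat_const (tau l) / ?F l
      = to_fract (monom (tau l) ?M * (\<Prod>j\<in>{..<L} - {l}. [:- phi p L j, 1:])) / (?U ^ ?M * ?P)"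
    if l: "l < L" for l
  proof -
    have "?P = ?F l * (\<Prod>j\<in>{..<L} - {l}. ?F j)"
      using l by (subst prod.remove[of _ l]) auto
    moreover have "(\<Prod>j\<in>{..<L} - {l}. ?F j) \<noteq> 0" using F0 by auto
    ultimately show ?thesis using F0[of l] U0
      by (simp only: to_fract_mult to_fract_prod mon flip: F) simp
  qed
  have sig: "rat_const (sig l) / ?U ^ (l + 1)
      = to_fract (monom (sig l) (?M - Suc l) * (\<Prod>l<L. [:- phi p L l, 1:])) / (?U ^ ?M * ?P)"
    if l: "l < ?M" for l
  proof -
    have "?U ^ ?M = ?U ^ (?M - Suc l) * ?U ^ (l + 1)"
      unfolding power_add[symmetric] using l by (intro arg_cong[where f = "power rat_u"]) simp
    then show ?thesis using P0 U0
      by (simp only: to_fract_mult mon flip: P) simp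
  qed
  have R: "(\<Sum>l<?M. rat_const (sig l) / ?U ^ (l + 1)) + (\<Sum>l<L. rat_const (tau l) / ?F l)
     = to_fract (pf_poly L ?M p sig tau) / (?U ^ ?M * ?P)"
    unfolding pf_poly_def to_fract_add sum_distrib_right to_fract_sum add_divide_distrib sum_divide_distrib
    using sig tau by (intro arg_cong2[where f = "(+)"] sum.cong refl) auto
  have Lh: "1 / (?U powi (int mu - int L + 1) * ?P) = to_fract (monom 1 ?k) / (?U ^ ?M * ?P)"
    unfolding pw mon by (simp add: pCons_one)
  have "?U ^ ?M * ?P \<noteq> 0" using U0 P0 by simp
  then show ?thesis
    unfolding partial_fractions_def den R Lh by (simp only: divide_cancel_right to_fract_eq_iff) simp
qed

text \<open>The formal identity is carried over to numbers by evaluating its polynomial form at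
  \<open>u\<close> and dividing by the common denominator, whose zeros are excluded by the
  hypotheses on \<open>u\<close>.\<close>

lemma partial_fractions_eval:
  assumes "L > 0" "p \<noteq> 0" "p ^ L = z ^ m" "partial_fractions m L mu z p sig tau"
    and u: "u \<noteq> 0" "u ^ L \<noteq> z ^ m"
  shows "1 / (u powi (int mu - int L + 1) * (u ^ L - z ^ m))
    = (\<Sum>l<mu + 1 - L. sig l / u ^ Suc l) + (\<Sum>l<L. tau l / (u - phi p L l))"
proof -
  let ?M = "mu + 1 - L" and ?k = "L - (mu + 1)"
  let ?P = "\<Prod>l<L. u - phi p L l"
  have P: "?P = u ^ L - z ^ m" using prod_phi_eval[OF assms(1,2)] assms(3) by simp
  then have P0: "?P \<noteq> 0" using u by simp
  have id: "u ^ ?k = (\<Sum>l<?M. sig l * u ^ (?M - Suc l)) * ?P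
      + (\<Sum>l<L. tau l * u ^ ?M * (\<Prod>j\<in>{..<L} - {l}. u - phi p L j))"
  proof -
    have e: "monom 1 ?k = pf_poly L ?M p sig tau"
      using assms(4) partial_fractions_iff[OF assms(1-3)] by blast
    show ?thesis
      using arg_cong[OF e, of "\<lambda>q. poly q u"]
      by (simp add: pf_poly_def poly_sum poly_prod poly_monom)
  qed
  have pw: "u powi (int mu - int L + 1) = u ^ ?M / u ^ ?k"
    by (rule power_int_diff_truncated)
  have tau: "tau l / (u - phi p L l)
      = tau l * u ^ ?M * (\<Prod>j\<in>{..<L} - {l}. u - phi p L j) / (u ^ ?M * ?P)"
    if l: "l < L" for l
  proof -
    have "?P = (u - phi p L l) * (\<Prod>j\<in>{..<L} - {l}. u - phi p L j)"
      using l by (subst prod.remove[of _ l]) auto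
    then show ?thesis using P0 u by auto
  qed
  have sig: "sig l / u ^ Suc l = sig l * u ^ (?M - Suc l) * ?P / (u ^ ?M * ?P)"
    if l: "l < ?M" for l
  proof -
    have "u ^ ?M = u ^ (?M - Suc l) * u ^ (Suc l)"
      unfolding power_add[symmetric] using l by (intro arg_cong[where f = "power u"]) simp
    then show ?thesis using P0 u by simp
  qed
  have "1 / (u powi (int mu - int L + 1) * ?P) = u ^ ?k / (u ^ ?M * ?P)"
    unfolding pw by simp
  also have "\<dots> = (\<Sum>l<?M. sig l / u ^ Suc l) + (\<Sum>l<L. tau l / (u - phi p L l))"
    unfolding id add_divide_distrib sum_divide_distrib sum_distrib_right
    using sig tau by (intro arg_cong2[where f = "(+)"] sum.cong refl) auto
  finally show ?thesis unfolding P .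
qed

section \<open>Power series coefficients and the moments of the decomposition\<close>

lemma higher_deriv_powser_0:
  fixes g :: "nat \<Rightarrow> complex"
  assumes "r > 0" "\<And>z. norm z < r \<Longrightarrow> (\<lambda>n. g n * z ^ n) sums f z"
  shows "(deriv ^^ n) f 0 = fact n * g n"
proof -
  have "eventually (\<lambda>z. z \<in> ball 0 r) (nhds (0::complex))"
    using assms(1) by (intro eventually_nhds_in_open) auto
  then have "eventually (\<lambda>z. (\<lambda>n. fps_nth (Abs_fps g) n * z ^ n) sums f z) (nhds 0)"
    by eventually_elim (use assms(2) in auto)
  then have "f has_fps_expansion Abs_fps g" by (rule has_fps_expansionI)
  from fps_nth_fps_expansion[OF this, of n] show ?thesis by (simp add: field_simps)
qed

text \<open>The function \<open>z * f z\<close> vanishes at 0 whatever \<open>f 0\<close> is, so it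
  has a power series on the full disc, with coefficients shifted by one. The point 0 is left out
  because the lemma serves the substitution \<open>u = 1/v\<close>.\<close>

lemma powser_unique_punctured:
  fixes a b :: "nat \<Rightarrow> complex"
  assumes "r > 0"
    and "\<And>z. 0 < norm z \<Longrightarrow> norm z < r \<Longrightarrow> (\<lambda>n. a n * z ^ n) sums f z"
    and "\<And>z. 0 < norm z \<Longrightarrow> norm z < r \<Longrightarrow> (\<lambda>n. b n * z ^ n) sums f z"
  shows "a n = b n"
proof -
  have *: "(deriv ^^ Suc n) (\<lambda>z. z * f z) 0 = fact (Suc n) * c n"
    if c: "\<And>z. 0 < norm z \<Longrightarrow> norm z < r \<Longrightarrow> (\<lambda>n. c n * z ^ n) sums f z" for c
  proof -
    have "(\<lambda>n. (case n of 0 \<Rightarrow> 0 | Suc k \<Rightarrow> c k) * z ^ n) sums (z * f z)" if z: "norm z < r" for z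
    proof (cases "z = 0")
      case False
      then have "(\<lambda>n. z * (c n * z ^ n)) sums (z * f z)"
        using c z by (intro sums_mult) auto
      then show ?thesis
        using sums_Suc_iff[of "\<lambda>n. (case n of 0 \<Rightarrow> 0 | Suc k \<Rightarrow> c k) * z ^ n" "z * f z"]
        by (simp add: mult_ac)
    qed (auto simp: powser_sums_zero_iff)
    from higher_deriv_powser_0[OF assms(1) this, where n = "Suc n"] show ?thesis by simp
  qed
  have "fact (Suc n) * a n = fact (Suc n) * b n"
    using *[of a] *[of b] assms(2,3) by metis
  then show ?thesis by (simp del: fact_Suc)
qed

text \<open>The indices \<open>mu + q * L\<close> increase strictly with \<open>q\<close>, and all
  terms off this progression are 0.\<close>

lemma sums_progression:
  fixes Z :: complex
  assumes "L > 0"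
  shows "(\<lambda>n. (if n \<ge> mu \<and> L dvd n - mu then Z ^ ((n - mu) div L) else 0) * c n) sums s
    \<longleftrightarrow> (\<lambda>q. Z ^ q * c (mu + q * L)) sums s"
proof -
  have "strict_mono (\<lambda>q. mu + q * L)" using assms by (intro strict_monoI) auto
  moreover have "(if n \<ge> mu \<and> L dvd n - mu then Z ^ ((n - mu) div L) else 0) * c n = 0"
    if n: "n \<notin> range (\<lambda>q. mu + q * L)" for n
  proof -
    have "\<not> (n \<ge> mu \<and> L dvd n - mu)"
    proof
      assume *: "n \<ge> mu \<and> L dvd n - mu"
      then obtain q where "n - mu = L * q" by (auto elim: dvdE)
      then have "n = mu + q * L" using * by (simp add: mult.commute)
      then show False using n by auto
    qed
    then show ?thesis by auto
  qed
  ultimately show ?thesis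
    using sums_mono_reindex[of "\<lambda>q. mu + q * L"
        "\<lambda>n. (if n \<ge> mu \<and> L dvd n - mu then Z ^ ((n - mu) div L) else 0) * c n" s] assms
    by simp
qed

text \<open>With \<open>u = 1/v\<close>, both sides are the coefficients of
  \<open>v^mu / (1 - z^m v^L)\<close>: the left one from a geometric series for each root, the right
  one from a single geometric series in \<open>z^m v^L\<close>.\<close>

lemma partial_fractions_moments:
  assumes "L > 0" "p \<noteq> 0" "p ^ L = z ^ m" "partial_fractions m L mu z p sig tau"
  shows "(if n < mu + 1 - L then sig n else 0) + (\<Sum>l<L. tau l * phi p L l ^ n)
    = (if n \<ge> mu \<and> L dvd n - mu then (z ^ m) ^ ((n - mu) div L) else 0)"
proof (rule powser_unique_punctured[where
      a = "\<lambda>n. (if n < mu + 1 - L then sig n else 0) + (\<Sum>l<L. tau l * phi p L l ^ n)" and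
      b = "\<lambda>n. if n \<ge> mu \<and> L dvd n - mu then (z ^ m) ^ ((n - mu) div L) else 0"])
  \<comment> \<open>This radius ensures \<open>norm (p * v) < 1\<close>. All roots have modulus
    \<open>norm p\<close>, and \<open>z^m v^L\<close> is the \<open>L\<close>-th power of
    \<open>p * v\<close>, so every geometric series involved converges.\<close>
  show "inverse (1 + norm p) > 0" by (simp add: add_pos_nonneg)
next
  fix v :: complex
  assume v: "0 < norm v" "norm v < inverse (1 + norm p)"
  have np: "1 + norm p > 0" by (simp add: add_pos_nonneg)
  have vp: "norm v * (1 + norm p) < 1"
    using v np by (simp add: field_simps)
  then have "norm v + norm (p * v) < 1" by (simp add: norm_mult algebra_simps)
  then have pv: "norm (p * v) < 1" using v(1) by linarith
  have ph: "norm (phi p L l * v) < 1" for l using pv by (simp add: norm_mult norm_phi)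
  have Zv: "norm (z ^ m * v ^ L) < 1"
  proof -
    have "z ^ m * v ^ L = (p * v) ^ L" by (simp add: assms(3)[symmetric] power_mult_distrib)
    then show ?thesis using pv assms(1) by (simp add: norm_power power_less_one_iff)
  qed
  let ?u = "inverse v"
  have u0: "?u \<noteq> 0" using v by auto
  have nz: "1 - z ^ m * v ^ L \<noteq> 0" using Zv by auto
  have fac: "?u ^ L - z ^ m = ?u ^ L * (1 - z ^ m * v ^ L)"
    using u0 by (simp add: field_simps)
  have uL: "?u ^ L \<noteq> z ^ m"
  proof
    assume "?u ^ L = z ^ m"
    then have "?u ^ L * (1 - z ^ m * v ^ L) = 0" using fac by simp
    then show False using nz u0 by simp
  qed
  have phu: "1 - phi p L l * v \<noteq> 0" for l using ph[of l] by auto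
  let ?S = "(\<Sum>l<mu + 1 - L. sig l * v ^ l) + (\<Sum>l<L. tau l / (1 - phi p L l * v))"
  have "v * ?S = (\<Sum>l<mu + 1 - L. sig l / ?u ^ Suc l) + (\<Sum>l<L. tau l / (?u - phi p L l))"
    unfolding distrib_left sum_distrib_left
    using u0 phu by (intro arg_cong2[where f = "(+)"] sum.cong refl) (auto simp: field_simps)
  also have "\<dots> = 1 / (?u powi (int mu - int L + 1) * (?u ^ L - z ^ m))"
    using partial_fractions_eval[OF assms u0 uL] by simp
  also have "?u powi (int mu - int L + 1) * (?u ^ L - z ^ m)
      = (?u powi (int mu - int L + 1) * ?u powi (int L)) * (1 - z ^ m * v ^ L)"
    unfolding fac by simp
  \<comment> \<open>Taking \<open>u^L\<close> out of the second factor raises the exponent to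
    \<open>mu + 1\<close>, which is positive whatever the sign of \<open>mu - L + 1\<close>.\<close>
  also have "?u powi (int mu - int L + 1) * ?u powi (int L) = ?u powi (int (Suc mu))"
    using u0 by (subst power_int_add[symmetric]) (auto simp: add.commute)
  also have "1 / (?u powi (int (Suc mu)) * (1 - z ^ m * v ^ L)) = v * (v ^ mu / (1 - z ^ m * v ^ L))"
    unfolding power_int_of_nat using u0 by (simp add: field_simps)
  finally have "v * ?S = v * (v ^ mu / (1 - z ^ m * v ^ L))" .
  then have S: "?S = v ^ mu / (1 - z ^ m * v ^ L)"
    using u0 by (subst (asm) mult_left_cancel) auto
  have "(\<lambda>n. (if n < mu + 1 - L then sig n * v ^ n else 0)) sums (\<Sum>l<mu + 1 - L. sig l * v ^ l)"
    using sums_If_finite_set[of "{..<mu + 1 - L}" "\<lambda>n. sig n * v ^ n"] by simp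
  moreover have "(\<lambda>n. \<Sum>l<L. tau l * (phi p L l * v) ^ n) sums (\<Sum>l<L. tau l * (1 / (1 - phi p L l * v)))"
    by (intro sums_sum sums_mult geometric_sums ph)
  ultimately have "(\<lambda>n. (if n < mu + 1 - L then sig n * v ^ n else 0)
      + (\<Sum>l<L. tau l * (phi p L l * v) ^ n)) sums ?S"
    by (intro sums_add) auto
  then show "(\<lambda>n. ((if n < mu + 1 - L then sig n else 0) + (\<Sum>l<L. tau l * phi p L l ^ n)) * v ^ n)
      sums ?S"
    by (rule sums_cong[THEN iffD1, rotated])
      (auto simp: distrib_right sum_distrib_right power_mult_distrib mult.assoc)
  have "(\<lambda>q. v ^ mu * (z ^ m * v ^ L) ^ q) sums (v ^ mu * (1 / (1 - z ^ m * v ^ L)))"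
    by (intro sums_mult geometric_sums Zv)
  then have "(\<lambda>q. (z ^ m) ^ q * v ^ (mu + q * L)) sums (v ^ mu * (1 / (1 - z ^ m * v ^ L)))"
    by (rule sums_cong[THEN iffD1, rotated])
      (simp add: power_mult_distrib power_add mult_ac flip: power_mult)
  then show "(\<lambda>n. (if n \<ge> mu \<and> L dvd n - mu then (z ^ m) ^ ((n - mu) div L) else 0) * v ^ n) sums ?S"
    unfolding S by (simp add: sums_progression[OF assms(1)])
qed

section \<open>Series with coefficients of linear growth, and Cauchy's formulas\<close>

text \<open>The majorant is a multiple of the differentiated geometric series.\<close>

lemma summable_linear_growth:
  fixes g :: "nat \<Rightarrow> complex"
  assumes "\<And>n. norm (g n) \<le> C * (real n + 1)" "norm z < 1"
  shows "summable (\<lambda>n. norm (g n * z ^ n))"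
proof (rule summable_comparison_test')
  show "summable (\<lambda>n. C * (of_nat (Suc n) * norm z ^ n))"
    using geometric_deriv_sums[of "norm z"] assms(2)
    by (intro summable_mult) (auto simp: sums_iff)
  show "norm (norm (g n * z ^ n)) \<le> C * (of_nat (Suc n) * norm z ^ n)" if "n \<ge> 0" for n
  proof -
    have "norm (g n * z ^ n) = norm (g n) * norm z ^ n" by (simp add: norm_mult norm_power)
    also have "\<dots> \<le> (C * (real n + 1)) * norm z ^ n" by (intro mult_right_mono assms) auto
    finally show ?thesis by (simp add: algebra_simps)
  qed
qed

lemma powser_linear_growth_sums:
  fixes g :: "nat \<Rightarrow> complex"
  assumes "\<And>n. norm (g n) \<le> C * (real n + 1)" "norm z < 1"
  shows "(\<lambda>n. g n * z ^ n) sums (\<Sum>n. g n * z ^ n)"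
  by (rule summable_sums[OF summable_norm_cancel[OF summable_linear_growth[OF assms]]])

text \<open>The moment identity is multiplied by \<open>g n\<close> and summed over
  \<open>n\<close>. The \<open>sig\<close> part is a finite sum with \<open>g l\<close> equal to the
  \<open>l\<close>-th derivative of \<open>P\<close> at 0 over \<open>fact l\<close>; the
  \<open>tau\<close> part gives values of \<open>P\<close> at the roots, which lie in the unit
  disc.\<close>

lemma sums_partial_fractions:
  fixes g :: "nat \<Rightarrow> complex"
  assumes pf: "L > 0" "p \<noteq> 0" "p ^ L = z ^ m" "partial_fractions m L mu z p sig tau"
    and g: "\<And>n. norm (g n) \<le> C * (real n + 1)" and p: "norm p < 1"
    and P: "\<And>\<zeta>. norm \<zeta> < 1 \<Longrightarrow> P \<zeta> = (\<Sum>n. g n * \<zeta> ^ n)"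
  shows "(\<lambda>q. g (mu + q * L) * (z ^ m) ^ q) sums
    ((\<Sum>l<mu + 1 - L. sig l / fact l * (deriv ^^ l) P 0) + (\<Sum>l<L. tau l * P (phi p L l)))"
proof -
  have gP: "(\<lambda>n. g n * \<zeta> ^ n) sums P \<zeta>" if "norm \<zeta> < 1" for \<zeta>
    using powser_linear_growth_sums[OF g that] P[OF that] by simp
  have D: "(deriv ^^ l) P 0 = fact l * g l" for l
    by (rule higher_deriv_powser_0[of 1]) (use gP in auto)
  have "(\<lambda>n. if n < mu + 1 - L then sig n * g n else 0) sums (\<Sum>l<mu + 1 - L. sig l * g l)"
    using sums_If_finite_set[of "{..<mu + 1 - L}" "\<lambda>n. sig n * g n"] by simp
  moreover have "(\<lambda>n. \<Sum>l<L. tau l * (g n * phi p L l ^ n)) sums (\<Sum>l<L. tau l * P (phi p L l))"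
    by (intro sums_sum sums_mult gP) (simp add: norm_phi p)
  ultimately have "(\<lambda>n. (if n < mu + 1 - L then sig n * g n else 0)
      + (\<Sum>l<L. tau l * (g n * phi p L l ^ n)))
     sums ((\<Sum>l<mu + 1 - L. sig l * g l) + (\<Sum>l<L. tau l * P (phi p L l)))"
    by (rule sums_add)
  moreover have "(if n < mu + 1 - L then sig n * g n else 0) + (\<Sum>l<L. tau l * (g n * phi p L l ^ n))
     = ((if n < mu + 1 - L then sig n else 0) + (\<Sum>l<L. tau l * phi p L l ^ n)) * g n" for n
    by (simp add: distrib_left sum_distrib_left mult_ac)
  ultimately show ?thesis
    by (simp only: partial_fractions_moments[OF pf] sums_progression[OF pf(1)]) (simp add: D mult.commute)
qed

text \<open>All poles of the decomposition lie inside the circle. Cauchy's formula for derivatives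
  treats the pole at 0, and Cauchy's integral formula treats each simple pole
  \<open>phi p L l\<close>.\<close>

lemma contour_integral_partial_fractions:
  assumes pf: "L > 0" "p \<noteq> 0" "p ^ L = z ^ m" "partial_fractions m L mu z p sig tau"
    and P: "P holomorphic_on ball 0 1" and \<rho>: "norm p < \<rho>" "\<rho> < 1"
  shows "contour_integral (circlepath 0 \<rho>)
      (\<lambda>u. P u / (u powi (int mu - int L + 1) * (u ^ L - z ^ m)))
    = 2 * of_real pi * \<i> * ((\<Sum>l<mu + 1 - L. sig l / fact l * (deriv ^^ l) P 0)
        + (\<Sum>l<L. tau l * P (phi p L l)))"
proof -
  have rp: "\<rho> > 0" using \<rho>(1) by (meson le_less_trans norm_ge_zero)
  have "cball 0 \<rho> \<subseteq> ball (0::complex) 1" using \<rho>(2) by auto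
  then have cont: "continuous_on (cball 0 \<rho>) P" and hol: "P holomorphic_on ball 0 \<rho>"
    using P \<rho>(2) by (auto intro: holomorphic_on_imp_continuous_on holomorphic_on_subset)
  have "((\<lambda>u. (\<Sum>l<mu + 1 - L. sig l * (P u / (u - 0) ^ Suc l)) + (\<Sum>l<L. tau l * (P u / (u - phi p L l))))
     has_contour_integral
      ((\<Sum>l<mu + 1 - L. sig l * ((2 * pi * \<i>) / fact l * (deriv ^^ l) P 0))
        + (\<Sum>l<L. tau l * (2 * of_real pi * \<i> * P (phi p L l))))) (circlepath 0 \<rho>)"
    by (intro has_contour_integral_add has_contour_integral_sum has_contour_integral_lmul
        Cauchy_has_contour_integral_higher_derivative_circlepath Cauchy_integral_circlepath cont hol)
      (use \<rho> rp in \<open>auto simp: norm_phi\<close>)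
  then have "((\<lambda>u. P u / (u powi (int mu - int L + 1) * (u ^ L - z ^ m))) has_contour_integral
      ((\<Sum>l<mu + 1 - L. sig l * ((2 * pi * \<i>) / fact l * (deriv ^^ l) P 0))
        + (\<Sum>l<L. tau l * (2 * of_real pi * \<i> * P (phi p L l))))) (circlepath 0 \<rho>)"
  proof (rule has_contour_integral_eq)
    fix u assume "u \<in> path_image (circlepath 0 \<rho>)"
    then have nu: "norm u = \<rho>" using rp by (auto simp: path_image_circlepath)
    have u0: "u \<noteq> 0" using nu rp by auto
    \<comment> \<open>On the circle \<open>norm (u^L)\<close> exceeds
      \<open>norm (p^L) = norm (z^m)\<close>, so the denominator has no zero there.\<close>
    have "norm p ^ L < norm u ^ L" using nu \<rho> pf(1) by (intro power_strict_mono) auto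
    then have "norm (u ^ L) \<noteq> norm (z ^ m)" by (simp only: norm_power flip: pf(3))
    then have "u ^ L \<noteq> z ^ m" by auto
    from partial_fractions_eval[OF pf u0 this]
    have "P u / (u powi (int mu - int L + 1) * (u ^ L - z ^ m))
      = P u * ((\<Sum>l<mu + 1 - L. sig l / u ^ Suc l) + (\<Sum>l<L. tau l / (u - phi p L l)))"
      by (metis times_divide_eq_right mult.right_neutral)
    then show "(\<Sum>l<mu + 1 - L. sig l * (P u / (u - 0) ^ Suc l)) + (\<Sum>l<L. tau l * (P u / (u - phi p L l)))
       = P u / (u powi (int mu - int L + 1) * (u ^ L - z ^ m))"
      by (simp add: distrib_left sum_distrib_left mult_ac)
  qed
  from contour_integral_unique[OF this] show ?thesis
    by (simp add: distrib_left sum_distrib_left mult_ac)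
qed

section \<open>Interchange of double series\<close>

text \<open>A product majorant makes the family absolutely summable over all pairs, so the
  interchange holds for \<open>infsum\<close>; rows and columns are then summable too, which allows
  the return to \<open>suminf\<close>.\<close>

lemma suminf_swap_dominated:
  fixes f :: "nat \<Rightarrow> nat \<Rightarrow> complex"
  assumes "\<And>k n. norm (f k n) \<le> X k * Y n" "summable X" "summable Y"
    and "\<And>k. X k \<ge> 0" "\<And>n. Y n \<ge> 0"
  shows "(\<Sum>k. \<Sum>n. f k n) = (\<Sum>n. \<Sum>k. f k n)"
proof -
  have X: "X summable_on UNIV" and Y: "Y summable_on UNIV"
    using assms by (auto simp: summable_on_UNIV_nonneg_real_iff)
  have "(\<lambda>(k, n). X k * Y n) summable_on UNIV \<times> UNIV"
    by (rule summable_on_SigmaI[where g = "\<lambda>k. X k * infsum Y UNIV"])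
      (use X Y assms in \<open>auto intro!: has_sum_cmult_right has_sum_infsum summable_on_cmult_left\<close>)
  then have "(\<lambda>x. norm (case x of (k, n) \<Rightarrow> f k n)) summable_on UNIV \<times> UNIV"
    by (rule Infinite_Sum.abs_summable_on_comparison_test') (use assms(1) in auto)
  then have sm: "(\<lambda>(k, n). f k n) summable_on UNIV \<times> UNIV"
    by (rule abs_summable_summable)
  have sm': "(\<lambda>(n, k). f k n) summable_on UNIV \<times> UNIV"
    using sm by (subst summable_on_swap) (simp add: case_prod_unfold)
  have eq: "suminf h = infsum h UNIV" if "h summable_on UNIV" for h :: "nat \<Rightarrow> complex"
    using has_sum_imp_sums[OF has_sum_infsum[OF that]] by (simp add: sums_iff)
  have "f k summable_on UNIV" "(\<lambda>k. f k n) summable_on UNIV" for k n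
    using summable_on_SigmaD1[OF sm, of k] summable_on_SigmaD1[OF sm', of n] by auto
  then show ?thesis
    using summable_on_Sigma_banach[OF sm] summable_on_Sigma_banach[OF sm'] infsum_swap_banach[OF sm]
    by (simp add: eq)
qed

section \<open>Collatz maps: residue classes, growth of iterates, coefficients of
  \<open>F\<close>\<close>

lemma collatz_max_norm:
  assumes "collatz_map m a b t" "r < m"
  shows "0 < a r" "a r \<le> max_norm m a"
proof -
  have "a r * real m \<in> \<nat> - {0}" using assms by (auto simp: collatz_map_def collatz_vectors_def)
  then have "a r * real m \<ge> 0" "a r * real m \<noteq> 0" by (auto elim!: Nats_cases)
  then have "a r * real m > 0" by linarith
  then show "0 < a r" by (simp add: zero_less_mult_iff)
  have "\<bar>a r\<bar> \<le> max_norm m a"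
    unfolding max_norm_def using assms(2) by (intro Max_ge) auto
  then show "a r \<le> max_norm m a" by simp
qed

text \<open>The values on a residue class form precisely the progression on which the moments of the
  decomposition are supported.\<close>

lemma collatz_map_residue:
  assumes "collatz_map m a b t" "r < m" "real lam = a r * real m" "real mu = a r * real r + b r"
  shows "t (q * m + r) = mu + q * lam"
proof -
  have "real (t (q * m + r)) = a r * real (q * m + r) + b r"
    using assms(1,2) by (simp add: collatz_map_def)
  also have "\<dots> = real (mu + q * lam)"
    using assms(3,4) by (simp add: algebra_simps)
  finally show ?thesis by linarith
qed

text \<open>Each series over a residue class is padded with zeros, and finitely many padded series
  are added termwise. No rearrangement takes place, so convergence need not be absolute.\<close>

lemma sums_over_residues:
  fixes h :: "nat \<Rightarrow> complex"
  assumes "m > 0" "\<And>r. r < m \<Longrightarrow> (\<lambda>q. h (q * m + r)) sums s r"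
  shows "h sums (\<Sum>r<m. s r)"
proof -
  have "(\<lambda>n. if n mod m = r then h n else 0) sums s r" if r: "r < m" for r
  proof -
    have "strict_mono (\<lambda>q. q * m + r)" using assms(1) by (intro strict_monoI) auto
    moreover have "(if n mod m = r then h n else 0) = 0" if n: "n \<notin> range (\<lambda>q. q * m + r)" for n
    proof -
      have "n mod m \<noteq> r"
      proof
        assume "n mod m = r"
        then have "n = n div m * m + r" using div_mult_mod_eq[of n m] by simp
        with n show False by blast
      qed
      then show ?thesis by simp
    qed
    ultimately show ?thesis
      using sums_mono_reindex[of "\<lambda>q. q * m + r" "\<lambda>n. if n mod m = r then h n else 0" "s r"]
        assms(2)[OF r] r by simp
  qed
  then have "(\<lambda>n. \<Sum>r<m. if n mod m = r then h n else 0) sums (\<Sum>r<m. s r)"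
    by (intro sums_sum) auto
  moreover have "(\<Sum>r<m. if n mod m = r then h n else 0) = h n" for n
    using assms(1) by simp
  ultimately show ?thesis by simp
qed

text \<open>One step satisfies \<open>t j \<le> A * j + B\<close>, which is iterated. The final form
  is a function of \<open>k\<close> times \<open>real n + 1\<close>: linear growth in
  \<open>n\<close> for fixed \<open>k\<close>, and a product majorant for the double series.\<close>

lemma collatz_iterate_bound:
  assumes "collatz_map m a b t"
  defines "A \<equiv> max (max_norm m a) 1" and "B \<equiv> \<Sum>r<m. \<bar>b r\<bar>"
  shows "real ((t ^^ k) n) \<le> A ^ k * ((1 + B) * (real k + 1)) * (real n + 1)"
proof -
  have A: "A \<ge> 1" by (simp add: A_def)
  have B: "B \<ge> 0" by (simp add: B_def sum_nonneg)
  have t: "real (t j) \<le> A * real j + B" for j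
  proof -
    have r: "j mod m < m" using assms(1) by (auto simp: collatz_map_def collatz_vectors_def)
    have "b (j mod m) \<le> \<bar>b (j mod m)\<bar>" by simp
    also have "\<dots> \<le> B" unfolding B_def using r by (intro member_le_sum) auto
    finally have "b (j mod m) \<le> B" .
    moreover have "a (j mod m) * real j \<le> A * real j"
      using collatz_max_norm(2)[OF assms(1) r] by (intro mult_right_mono) (auto simp: A_def)
    ultimately show ?thesis using assms(1) by (simp add: collatz_map_def)
  qed
  have *: "real ((t ^^ k) n) \<le> A ^ k * (real n + real k * B)"
  proof (induction k)
    case (Suc k)
    have "real ((t ^^ Suc k) n) \<le> A * real ((t ^^ k) n) + B" using t by simp
    also have "\<dots> \<le> A * (A ^ k * (real n + real k * B)) + A ^ Suc k * B"
    proof (rule add_mono)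
      show "A * real ((t ^^ k) n) \<le> A * (A ^ k * (real n + real k * B))"
        using Suc A by (intro mult_left_mono) auto
      \<comment> \<open>Here \<open>A \<ge> 1\<close> is used; it lets the new summand
        \<open>B\<close> be absorbed with the same power of \<open>A\<close> as the others.\<close>
      have "1 * B \<le> A ^ Suc k * B" using A B by (intro mult_right_mono one_le_power)
      then show "B \<le> A ^ Suc k * B" by simp
    qed
    finally show ?case by (simp add: algebra_simps)
  qed simp
  also have "A ^ k * (real n + real k * B) \<le> A ^ k * ((1 + B) * (real k + 1) * (real n + 1))"
  proof (rule mult_left_mono)
    have "0 \<le> 1 + real k + real k * real n + B + B * real n + B * real k * real n"
      using B by simp
    then show "real n + real k * B \<le> (1 + B) * (real k + 1) * (real n + 1)"
      by (simp add: algebra_simps)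
  qed (use A in auto)
  finally show ?thesis by (simp add: mult.assoc)
qed

text \<open>On the class of \<open>r\<close>, the term at \<open>n = q * m + r\<close> is
  \<open>z^r * g (mu r + q * lam r) * (z^m)^q\<close>, so the series for a single progression
  applies to each class. The coefficients \<open>g\<close> stay arbitrary so that one lemma serves
  both \<open>f_k\<close> and \<open>F\<close>.\<close>

lemma sums_collatz_partial_fractions:
  fixes g :: "nat \<Rightarrow> complex" and sig tau :: "nat \<Rightarrow> nat \<Rightarrow> complex"
  assumes "collatz_map m a b t"
    and "\<And>r. r < m \<Longrightarrow> real (lam r) = a r * real m"
    and "\<And>r. r < m \<Longrightarrow> real (mu r) = a r * real r + b r"
    and pf: "\<And>r. r < m \<Longrightarrow> lam r > 0 \<and> p r \<noteq> 0 \<and> norm (p r) < 1 \<and> p r ^ lam r = z ^ m \<and>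
        partial_fractions m (lam r) (mu r) z (p r) (sig r) (tau r)"
    and g: "\<And>n. norm (g n) \<le> C * (real n + 1)"
    and P: "\<And>\<zeta>. norm \<zeta> < 1 \<Longrightarrow> P \<zeta> = (\<Sum>n. g n * \<zeta> ^ n)"
  shows "(\<lambda>n. g (t n) * z ^ n) sums
     (\<Sum>r<m. z ^ r * ((\<Sum>l<mu r + 1 - lam r. sig r l / fact l * (deriv ^^ l) P 0)
               + (\<Sum>l<lam r. tau r l * P (phi (p r) (lam r) l))))"
proof (rule sums_over_residues)
  show "m > 0" using assms(1) by (auto simp: collatz_map_def collatz_vectors_def)
next
  fix r assume r: "r < m"
  have "(\<lambda>q. z ^ r * (g (mu r + q * lam r) * (z ^ m) ^ q)) sums
      (z ^ r * ((\<Sum>l<mu r + 1 - lam r. sig r l / fact l * (deriv ^^ l) P 0)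
               + (\<Sum>l<lam r. tau r l * P (phi (p r) (lam r) l))))"
    using pf[OF r] by (intro sums_mult sums_partial_fractions[where C = C] g P) auto
  then show "(\<lambda>q. g (t (q * m + r)) * z ^ (q * m + r)) sums
      (z ^ r * ((\<Sum>l<mu r + 1 - lam r. sig r l / fact l * (deriv ^^ l) P 0)
               + (\<Sum>l<lam r. tau r l * P (phi (p r) (lam r) l))))"
    by (simp add: collatz_map_residue[OF assms(1) r assms(2,3)[OF r]]
        power_add mult_ac flip: power_mult)
qed

lemma gen_F_coefficients:
  assumes t: "collatz_map m a b t" and w: "norm w < w_radius m a"
  defines "c \<equiv> \<lambda>n. \<Sum>k. of_nat ((t ^^ k) n) * w ^ k"
  obtains C where "\<And>n. norm (c n) \<le> C * (real n + 1)"
    "\<And>\<zeta>. norm \<zeta> < 1 \<Longrightarrow> gen_F t \<zeta> w = (\<Sum>n. c n * \<zeta> ^ n)"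
    "\<And>n. c n = of_nat n + w * c (t n)"
proof -
  define A where "A = max (max_norm m a) 1"
  define B where "B = (\<Sum>r<m. \<bar>b r\<bar>)"
  define X where "X k = (A * norm w) ^ k * ((1 + B) * (real k + 1))" for k
  have A: "A \<ge> 1" by (simp add: A_def)
  have B: "B \<ge> 0" by (simp add: B_def sum_nonneg)
  have m: "m > 0" using t by (auto simp: collatz_map_def collatz_vectors_def)
  have mx: "max_norm m a > 0" using collatz_max_norm[OF t m] by linarith
  \<comment> \<open>Since \<open>max_norm m a\<close> is positive, \<open>w_radius m a\<close>
    equals \<open>1 / A\<close>.\<close>
  have Aw: "A * norm w < 1"
    using w mx by (auto simp: A_def w_radius_def max_def field_simps)
  have Xnn: "X k \<ge> 0" for k using A B by (auto simp: X_def)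
  \<comment> \<open>\<open>X\<close> is itself a power series in \<open>A * norm w\<close> with
    coefficients of linear growth in \<open>k\<close>; it is read in the complex numbers to reuse
    the earlier summability lemma.\<close>
  have "summable (\<lambda>k. norm ((complex_of_real ((1 + B) * (real k + 1))) * (complex_of_real (A * norm w)) ^ k))"
    using B A Aw by (intro summable_linear_growth[where C = "1 + B"])
      (auto simp: norm_mult simp flip: of_real_add of_real_mult)
  moreover have "norm ((complex_of_real ((1 + B) * (real k + 1))) * (complex_of_real (A * norm w)) ^ k) = X k" for k
    using B A unfolding X_def norm_mult norm_power norm_of_real by (simp add: mult.commute abs_mult)
  ultimately have X: "summable X" by simp
  have bd: "norm (of_nat ((t ^^ k) n) * w ^ k) \<le> X k * (real n + 1)" for k n
  proof -
    have "norm (of_nat ((t ^^ k) n) * w ^ k) = real ((t ^^ k) n) * norm w ^ k"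
      by (simp add: norm_mult norm_power)
    also have "\<dots> \<le> (A ^ k * ((1 + B) * (real k + 1)) * (real n + 1)) * norm w ^ k"
      unfolding A_def B_def by (intro mult_right_mono collatz_iterate_bound[OF t]) auto
    finally show ?thesis by (simp add: X_def power_mult_distrib mult_ac)
  qed
  have Xn: "summable (\<lambda>k. X k * (real n + 1))" for n using X by (rule summable_mult2)
  have sn: "summable (\<lambda>k. norm (of_nat ((t ^^ k) n) * w ^ k))" for n
    by (rule summable_comparison_test'[OF Xn[of n]]) (use bd in auto)
  have s: "summable (\<lambda>k. of_nat ((t ^^ k) n) * w ^ k)" for n
    using sn by (rule summable_norm_cancel)
  show thesis
  proof
    show "norm (c n) \<le> suminf X * (real n + 1)" for n
    proof -
      have "norm (c n) \<le> (\<Sum>k. norm (of_nat ((t ^^ k) n) * w ^ k))"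
        unfolding c_def by (rule summable_norm[OF sn])
      also have "\<dots> \<le> (\<Sum>k. X k * (real n + 1))" by (rule suminf_le[OF bd sn Xn])
      also have "\<dots> = suminf X * (real n + 1)" by (rule suminf_mult2[OF X, symmetric])
      finally show ?thesis .
    qed
    show "gen_F t \<zeta> w = (\<Sum>n. c n * \<zeta> ^ n)" if z: "norm \<zeta> < 1" for \<zeta>
    proof -
      have "gen_F t \<zeta> w = (\<Sum>n. \<Sum>k. of_nat ((t ^^ k) n) * \<zeta> ^ n * w ^ k)"
        unfolding gen_F_def
      proof (rule suminf_swap_dominated[where X = X and Y = "\<lambda>n. (real n + 1) * norm \<zeta> ^ n"])
        show "norm (of_nat ((t ^^ k) n) * \<zeta> ^ n * w ^ k) \<le> X k * ((real n + 1) * norm \<zeta> ^ n)" for k n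
          using mult_right_mono[OF bd[of k n], of "norm \<zeta> ^ n"]
          by (simp add: norm_mult norm_power mult_ac)
        show "summable (\<lambda>n. (real n + 1) * norm \<zeta> ^ n)"
          using geometric_deriv_sums[of "norm \<zeta>"] z by (simp add: sums_iff add.commute)
      qed (use X Xnn in auto)
      also have "\<dots> = (\<Sum>n. c n * \<zeta> ^ n)"
        unfolding c_def by (subst suminf_mult2[OF s]) (simp add: mult_ac)
      finally show ?thesis .
    qed
    show "c n = of_nat n + w * c (t n)" for n
    proof -
      \<comment> \<open>The tail from \<open>k = 1\<close> is computed twice: by removing the term
        \<open>k = 0\<close>, which is \<open>n\<close>, and by applying the first of the
        \<open>Suc k\<close> steps to \<open>n\<close>, which leaves \<open>k\<close> iterations
        starting at \<open>t n\<close>.\<close>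
      have "(\<Sum>k. of_nat ((t ^^ Suc k) n) * w ^ Suc k) = c n - of_nat n"
        unfolding c_def by (subst suminf_split_head[OF s]) simp
      moreover have "(\<Sum>k. of_nat ((t ^^ Suc k) n) * w ^ Suc k) = w * c (t n)"
        unfolding c_def by (subst suminf_mult[OF s, symmetric])
          (simp add: funpow_Suc_right mult_ac del: funpow.simps)
      ultimately have "w * c (t n) = c n - of_nat n" by metis
      then show ?thesis by (simp only: algebra_simps)
    qed
  qed
qed

section \<open>Decomposition, recursion for \<open>f_k\<close> and functional equation for
  \<open>F\<close>\<close>

theorem theorem2p1:
  fixes m :: nat and a b :: "nat \<Rightarrow> real" and t lam mu :: "nat \<Rightarrow> nat"
    and pw :: "nat \<Rightarrow> complex \<Rightarrow> complex"
  assumes t: "collatz_map m a b t"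
    and lam: "\<And>r. r < m \<Longrightarrow> real (lam r) = a r * real m"
    and mu: "\<And>r. r < m \<Longrightarrow> real (mu r) = a r * real r + b r"
    and pw: "\<And>r z. r < m \<Longrightarrow> z \<noteq> 0 \<Longrightarrow>
               power_determination z (real m / real (lam r)) (pw r z)"
  shows
    "(\<forall>z r. 0 < norm z \<and> norm z < 1 \<and> r < m \<longrightarrow>
        (\<exists>!st. st \<in> ({..<mu r + 1 - lam r} \<rightarrow>\<^sub>E UNIV) \<times> ({..<lam r} \<rightarrow>\<^sub>E UNIV) \<and>
               partial_fractions m (lam r) (mu r) z (pw r z) (fst st) (snd st)))
   \<and> (\<forall>sig tau :: nat \<Rightarrow> nat \<Rightarrow> complex \<Rightarrow> complex.
        (\<forall>z r. 0 < norm z \<and> norm z < 1 \<and> r < m \<longrightarrow>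
           partial_fractions m (lam r) (mu r) z (pw r z) (\<lambda>l. sig r l z) (\<lambda>l. tau r l z))
        \<longrightarrow>
        (\<forall>z k. 0 < norm z \<and> norm z < 1 \<and> k \<ge> 1 \<longrightarrow>
           (\<forall>\<rho>::real. \<rho> > 0 \<and> norm z powr (1 / max_norm m a) < \<rho> \<and> \<rho> < 1 \<longrightarrow>
              gen_f t k z =
                (\<Sum>r<m. z ^ r / (2 * of_real pi * \<i>) *
                   contour_integral (circlepath 0 \<rho>)
                     (\<lambda>u. gen_f t (k - 1) u /
                        (u powi (int (mu r) - int (lam r) + 1) * (u ^ lam r - z ^ m)))))
         \<and> gen_f t k z =
             (\<Sum>r<m. z ^ r *
                ((\<Sum>l<mu r + 1 - lam r. sig r l z / fact l * (deriv ^^ l) (gen_f t (k - 1)) 0)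
               + (\<Sum>l<lam r. tau r l z * gen_f t (k - 1) (phi (pw r z) (lam r) l)))))
      \<and> (\<forall>z. 0 < norm z \<and> norm z < 1 \<longrightarrow> gen_f t 0 z = z / (1 - z)\<^sup>2)
      \<and> (\<forall>z w. 0 < norm z \<and> norm z < 1 \<and> norm w < w_radius m a \<longrightarrow>
           gen_F t z w = gen_f t 0 z + w *
             (\<Sum>r<m. z ^ r *
                ((\<Sum>l<mu r + 1 - lam r.
                    sig r l z / fact l * (deriv ^^ l) (\<lambda>\<zeta>. gen_F t \<zeta> w) 0)
               + (\<Sum>l<lam r. tau r l z * gen_F t (phi (pw r z) (lam r) l) w)))))"
proof (intro conjI allI impI)
  have m: "m > 0" using t by (auto simp: collatz_map_def collatz_vectors_def)
  have apos: "a r > 0" "a r \<le> max_norm m a" if "r < m" for r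
    using collatz_max_norm[OF t that] by auto
  have L: "lam r > 0" if "r < m" for r
    using lam[OF that] apos(1)[OF that] m by (metis mult_pos_pos of_nat_0_less_iff)
  have p0: "pw r z \<noteq> 0" if "r < m" "z \<noteq> 0" for r z
    using pw[OF that] by (auto simp: power_determination_def)
  have pL: "pw r z ^ lam r = z ^ m" if "r < m" "z \<noteq> 0" for r z
    using power_determination_power[OF pw[OF that] L[OF that(1)]] .
  \<comment> \<open>The modulus of \<open>pw r z\<close> is that of \<open>z\<close> to the power
    \<open>1 / a r\<close>, and for a base below 1 a larger exponent gives a smaller power. So the
    lower bound on \<open>\<rho>\<close> puts the roots of all classes inside the circle.\<close>
  have np: "norm (pw r z) \<le> norm z powr (1 / max_norm m a)" "norm (pw r z) < 1"
    if "r < m" "0 < norm z" "norm z < 1" for r z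
  proof -
    have e: "real m / real (lam r) = 1 / a r" using lam[OF that(1)] m by simp
    have n: "norm (pw r z) = norm z powr (1 / a r)"
      using norm_power_determination[OF pw[of r z]] that unfolding e by auto
    have "1 / max_norm m a \<le> 1 / a r" using apos[OF that(1)] by (intro divide_left_mono) auto
    then show "norm (pw r z) \<le> norm z powr (1 / max_norm m a)"
      unfolding n using that by (intro powr_mono') auto
    show "norm (pw r z) < 1" unfolding n using that apos[OF that(1)]
      by (subst powr01_less_one) auto
  qed
  {
    fix z r assume "0 < norm (z :: complex) \<and> norm z < 1 \<and> r < m"
    then have r: "r < m" and z: "z \<noteq> 0" by auto
    define M where "M = mu r + 1 - lam r"
    note iff = partial_fractions_iff[OF L[OF r] p0[OF r z] pL[OF r z], where mu = "mu r", folded M_def]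
    have "degree (monom (1::complex) (lam r - (mu r + 1))) < lam r + M"
      using L[OF r] by (simp add: degree_monom_eq)
    then obtain sig tau where st: "monom 1 (lam r - (mu r + 1)) = pf_poly (lam r) M (pw r z) sig tau"
      using pf_poly_exists[OF p0[OF r z]] by blast
    \<comment> \<open>\<open>pf_poly\<close> reads only indices in range. Restriction fixes all
      other values, so uniqueness of an extensional pair is uniqueness of the finitely many
      coefficients.\<close>
    have "pf_poly (lam r) M (pw r z) (restrict sig {..<M}) (restrict tau {..<lam r})
        = pf_poly (lam r) M (pw r z) sig tau"
      unfolding pf_poly_def by simp
    then have ex: "partial_fractions m (lam r) (mu r) z (pw r z) (restrict sig {..<M}) (restrict tau {..<lam r})"
      using st iff by simp
    show "\<exists>!st. st \<in> ({..<mu r + 1 - lam r} \<rightarrow>\<^sub>E UNIV) \<times> ({..<lam r} \<rightarrow>\<^sub>E UNIV) \<and>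
               partial_fractions m (lam r) (mu r) z (pw r z) (fst st) (snd st)"
      unfolding M_def[symmetric]
    proof (rule ex1I)
      show "(restrict sig {..<M}, restrict tau {..<lam r}) \<in> ({..<M} \<rightarrow>\<^sub>E UNIV) \<times> ({..<lam r} \<rightarrow>\<^sub>E UNIV) \<and>
        partial_fractions m (lam r) (mu r) z (pw r z) (fst (restrict sig {..<M}, restrict tau {..<lam r}))
          (snd (restrict sig {..<M}, restrict tau {..<lam r}))"
        using ex by simp
    next
      fix st assume *: "st \<in> ({..<M} \<rightarrow>\<^sub>E UNIV) \<times> ({..<lam r} \<rightarrow>\<^sub>E UNIV) \<and>
               partial_fractions m (lam r) (mu r) z (pw r z) (fst st) (snd st)"
      then have "pf_poly (lam r) M (pw r z) (fst st) (snd st) = pf_poly (lam r) M (pw r z) sig tau"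
        using iff st by simp
      from pf_poly_unique[OF p0[OF r z] this]
      have eq: "\<forall>l<M. fst st l = sig l" "\<forall>l<lam r. snd st l = tau l" .
      have "fst st = restrict sig {..<M}"
        by (rule extensionalityI[where A = "{..<M}"]) (use * eq(1) in \<open>auto simp: PiE_def mem_Times_iff\<close>)
      moreover have "snd st = restrict tau {..<lam r}"
        by (rule extensionalityI[where A = "{..<lam r}"]) (use * eq(2) in \<open>auto simp: PiE_def mem_Times_iff\<close>)
      ultimately show "st = (restrict sig {..<M}, restrict tau {..<lam r})" by (metis prod.collapse)
    qed
  next
    fix z :: complex
    assume "0 < norm z \<and> norm z < 1"
    then have "norm z < 1" by simp
    then have "(\<lambda>n. z * (of_nat (Suc n) * z ^ n)) sums (z * (1 / (1 - z)\<^sup>2))"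
      by (intro sums_mult geometric_deriv_sums)
    then have "(\<lambda>n. of_nat (Suc n) * z ^ Suc n) sums (z / (1 - z)\<^sup>2)"
      by (simp add: mult_ac)
    then have "(\<lambda>n. of_nat n * z ^ n) sums (z / (1 - z)\<^sup>2)"
      using sums_Suc_iff[of "\<lambda>n. of_nat n * z ^ n" "z / (1 - z)\<^sup>2"] by simp
    then show "gen_f t 0 z = z / (1 - z)\<^sup>2"
      by (simp add: gen_f_def sums_iff)
  next
    fix sig tau :: "nat \<Rightarrow> nat \<Rightarrow> complex \<Rightarrow> complex"
    assume st: "\<forall>z r. 0 < norm z \<and> norm z < 1 \<and> r < m \<longrightarrow>
           partial_fractions m (lam r) (mu r) z (pw r z) (\<lambda>l. sig r l z) (\<lambda>l. tau r l z)"
    have pf: "lam r > 0 \<and> pw r z \<noteq> 0 \<and> norm (pw r z) < 1 \<and> pw r z ^ lam r = z ^ m \<and>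
        partial_fractions m (lam r) (mu r) z (pw r z) (\<lambda>l. sig r l z) (\<lambda>l. tau r l z)"
      if "0 < norm z" "norm z < 1" "r < m" for r z
      using that st L p0 pL np by auto
    {
      fix z w :: complex
      assume "0 < norm z \<and> norm z < 1 \<and> norm w < w_radius m a"
      then have z: "0 < norm z" "norm z < 1" and w: "norm w < w_radius m a" by auto
      define c where "c n = (\<Sum>k. of_nat ((t ^^ k) n) * w ^ k)" for n
      obtain C where C: "\<And>n. norm (c n) \<le> C * (real n + 1)"
        and F: "\<And>\<zeta>. norm \<zeta> < 1 \<Longrightarrow> gen_F t \<zeta> w = (\<Sum>n. c n * \<zeta> ^ n)"
        and c: "\<And>n. c n = of_nat n + w * c (t n)"
        using gen_F_coefficients[OF t w, folded c_def] by blast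
      let ?S = "(\<Sum>r<m. z ^ r *
                ((\<Sum>l<mu r + 1 - lam r.
                    sig r l z / fact l * (deriv ^^ l) (\<lambda>\<zeta>. gen_F t \<zeta> w) 0)
               + (\<Sum>l<lam r. tau r l z * gen_F t (phi (pw r z) (lam r) l) w)))"
      have "(\<lambda>n. c (t n) * z ^ n) sums ?S"
        by (rule sums_collatz_partial_fractions[OF t lam mu pf[OF z] C F])
      moreover have "(\<lambda>n. of_nat n * z ^ n) sums gen_f t 0 z"
        using powser_linear_growth_sums[of of_nat 1 z] z by (simp add: gen_f_def)
      ultimately have "(\<lambda>n. of_nat n * z ^ n + w * (c (t n) * z ^ n)) sums (gen_f t 0 z + w * ?S)"
        by (intro sums_add sums_mult)
      \<comment> \<open>Only \<open>c n\<close> on the right is expanded by the recursion; expanding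
        \<open>c (t n)\<close> would bring in a further iterate.\<close>
      moreover have "of_nat n * z ^ n + w * (c (t n) * z ^ n) = c n * z ^ n" for n
        by (subst (2) c) (simp add: algebra_simps)
      ultimately have "(\<lambda>n. c n * z ^ n) sums (gen_f t 0 z + w * ?S)" by simp
      then show "gen_F t z w = gen_f t 0 z + w * ?S"
        using F[OF z(2)] by (simp add: sums_iff)
    next
      fix z :: complex and k :: nat
      assume zk: "0 < norm z \<and> norm z < 1 \<and> k \<ge> 1"
      then have z: "0 < norm z" "norm z < 1" by auto
      obtain j where k: "k = Suc j" using zk by (cases k) auto
      define C where "C = max (max_norm m a) 1 ^ j * ((1 + (\<Sum>r<m. \<bar>b r\<bar>)) * (real j + 1))"
      have C: "norm (of_nat ((t ^^ j) n) :: complex) \<le> C * (real n + 1)" for n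
        using collatz_iterate_bound[OF t, of j n] by (simp add: C_def)
      have f: "gen_f t (k - 1) \<zeta> = (\<Sum>n. of_nat ((t ^^ j) n) * \<zeta> ^ n)" if "norm \<zeta> < 1" for \<zeta>
        by (simp add: gen_f_def k)
      \<comment> \<open>Since \<open>k = Suc j\<close>, the coefficients of \<open>f_k\<close> are
        \<open>g (t n)\<close> for \<open>g\<close> the \<open>j\<close>-th iterate, whose power
        series is the preceding generating function.\<close>
      have "(\<lambda>n. of_nat ((t ^^ j) (t n)) * z ^ n) sums
        (\<Sum>r<m. z ^ r *
                ((\<Sum>l<mu r + 1 - lam r. sig r l z / fact l * (deriv ^^ l) (gen_f t (k - 1)) 0)
               + (\<Sum>l<lam r. tau r l z * gen_f t (k - 1) (phi (pw r z) (lam r) l))))"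
        by (rule sums_collatz_partial_fractions[OF t lam mu pf[OF z] C f])
      then show *: "gen_f t k z = (\<Sum>r<m. z ^ r *
                ((\<Sum>l<mu r + 1 - lam r. sig r l z / fact l * (deriv ^^ l) (gen_f t (k - 1)) 0)
               + (\<Sum>l<lam r. tau r l z * gen_f t (k - 1) (phi (pw r z) (lam r) l))))"
        by (simp add: gen_f_def k funpow_Suc_right sums_iff del: funpow.simps)
      fix \<rho> :: real
      assume \<rho>: "\<rho> > 0 \<and> norm z powr (1 / max_norm m a) < \<rho> \<and> \<rho> < 1"
      have hol: "gen_f t (k - 1) holomorphic_on ball 0 1"
      proof (rule power_series_holomorphic)
        show "(\<lambda>n. of_nat ((t ^^ j) n) * (\<zeta> - 0) ^ n) sums gen_f t (k - 1) \<zeta>" if "\<zeta> \<in> ball 0 1" for \<zeta>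
          using powser_linear_growth_sums[OF C, of \<zeta>] f[of \<zeta>] that by simp
      qed
      have "z ^ r / (2 * of_real pi * \<i>) *
                   contour_integral (circlepath 0 \<rho>)
                     (\<lambda>u. gen_f t (k - 1) u /
                        (u powi (int (mu r) - int (lam r) + 1) * (u ^ lam r - z ^ m)))
          = z ^ r *
                ((\<Sum>l<mu r + 1 - lam r. sig r l z / fact l * (deriv ^^ l) (gen_f t (k - 1)) 0)
               + (\<Sum>l<lam r. tau r l z * gen_f t (k - 1) (phi (pw r z) (lam r) l)))"
        if r: "r < m" for r
      proof -
        have "norm (pw r z) < \<rho>" using np(1)[OF r z] \<rho> by linarith
        then have "contour_integral (circlepath 0 \<rho>)
                     (\<lambda>u. gen_f t (k - 1) u /
                        (u powi (int (mu r) - int (lam r) + 1) * (u ^ lam r - z ^ m)))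
          = 2 * of_real pi * \<i> *
                ((\<Sum>l<mu r + 1 - lam r. sig r l z / fact l * (deriv ^^ l) (gen_f t (k - 1)) 0)
               + (\<Sum>l<lam r. tau r l z * gen_f t (k - 1) (phi (pw r z) (lam r) l)))"
          using pf[OF z r] \<rho> hol
          by (intro contour_integral_partial_fractions[where p = "pw r z"]) auto
        moreover have "x / c * (c * y) = x * y" if "c \<noteq> 0" for x c y :: complex
          using that by simp
        moreover have "2 * of_real pi * \<i> \<noteq> (0 :: complex)" by simp
        ultimately show ?thesis by (simp only: not_False_eq_True)
      qed
      then show "gen_f t k z =
                (\<Sum>r<m. z ^ r / (2 * of_real pi * \<i>) *
                   contour_integral (circlepath 0 \<rho>)
                     (\<lambda>u. gen_f t (k - 1) u /
                        (u powi (int (mu r) - int (lam r) + 1) * (u ^ lam r - z ^ m))))"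
        unfolding * by simp
    }
  }
qed

end
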